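(* Let $N=\{1,\dots,n\}$ be a set of agents with $n\ge 2$, let $X$ be a finite set with $|X|\ge 3$, and let $\mathcal{P}$ be the set of all strict preferences over $X$. Let $\mathcal{S}$ be the set of all unanimous and strategy-proof rules $f:\mathcal{P}^n\to X$, and let $\mathcal{TE}$ be the set of all tops-only and efficient rules $f:\mathcal{P}^n\to X$. Then $\mathcal{S}\subseteq\mathcal{TE}$.
   Context: A strict preference $P_i$ over $X$ is a strict linear order on $X$ ($xP_iy$ means $x$ is strictly preferred to $y$); its top $t(P_i)$ is its best alternative. A profile is $P=(P_1,\dots,P_n)\in\mathcal{P}^n$; $(P_i',P_{-i})$ denotes the profile obtained from $P$ by replacing $P_i$ with $P_i'$. A (social choice) rule is a function $f:\mathcal{P}^n\to X$; as a standing assumption, rules are unanimous. - $f$ is unanimous if $f(P)=x$ whenever $t(P_i)=x$ for each $i\in N$. - $f$ is strategy-proof if there are no agent $i$, profile $P$ and preference $P_i'\in\mathcal{P}$ such that $f(P_i',P_{-i})\,P_i\,f(P)$. - $f$ is efficient if, for each $P\in\mathcal{P}^n$, there is no $x\in X$ such that $xP_if(P)$ for each $i\in N$. - $f$ is tops-only if $f(P)=f(P')$ for all $P,P'\in\mathcal{P}^n$ with $t(P_i)=t(P_i')$ for each $i\in N$. *)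

theory Defs
  imports "HOL-Library.FuncSet"
begin

text \<open>Throughout, \<open>X\<close> is the set of alternatives and \<open>{1..n}\<close> the set of agents.\<close>

text \<open>\<open>(x, y) \<in> r\<close> means that \<open>x\<close> is strictly preferred to \<open>y\<close>.  The constant
  \<open>strict_linear_order_on X\<close> does not by itself confine \<open>r\<close> to \<open>X\<close>.\<close>

definition prefs :: "'a set \<Rightarrow> 'a rel set" where
  "prefs X = {r. r \<subseteq> X \<times> X \<and> strict_linear_order_on X r}"

definition pref_top :: "'a set \<Rightarrow> 'a rel \<Rightarrow> 'a" where
  "pref_top X r = (THE x. x \<in> X \<and> (\<forall>y\<in>X. y \<noteq> x \<longrightarrow> (x, y) \<in> r))"

lemma pref_top_eqI:
  assumes "r \<in> prefs X" "x \<in> X" "\<And>y. y \<in> X \<Longrightarrow> y \<noteq> x \<Longrightarrow> (x, y) \<in> r"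
  shows "pref_top X r = x"
  unfolding pref_top_def
proof (rule the_equality)
  fix z assume z: "z \<in> X \<and> (\<forall>y\<in>X. y \<noteq> z \<longrightarrow> (z, y) \<in> r)"
  have "trans r" "irrefl r"
    using assms(1) by (auto simp: prefs_def strict_linear_order_on_def)
  then show "z = x"
    using z assms(2,3) by (metis irreflD transD)
qed (use assms in blast)

lemma pref_top_best:
  assumes r: "r \<in> prefs X" and X: "finite X" "X \<noteq> {}"
  shows "pref_top X r \<in> X \<and> (\<forall>y\<in>X. y \<noteq> pref_top X r \<longrightarrow> (pref_top X r, y) \<in> r)"
proof -
  have tr: "trans r" "irrefl r" and tot: "total_on X r" and sub: "r \<subseteq> X \<times> X"
    using r by (auto simp: prefs_def strict_linear_order_on_def)
  have "finite r"
    using sub X(1) by (meson finite_SigmaI finite_subset)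
  moreover have "acyclic r"
    using tr by (simp add: acyclic_irrefl)
  ultimately have "wf r"
    by (rule finite_acyclic_wf)
  then obtain x where x: "x \<in> X" "\<And>y. (y, x) \<in> r \<Longrightarrow> y \<notin> X"
    using X(2) by (metis wfE_min all_not_in_conv)
  then have "\<And>y. y \<in> X \<Longrightarrow> y \<noteq> x \<Longrightarrow> (x, y) \<in> r"
    using tot by (metis total_on_def)
  with x(1) pref_top_eqI[OF r x(1)] show ?thesis by metis
qed

definition profiles :: "nat \<Rightarrow> 'a set \<Rightarrow> (nat \<Rightarrow> 'a rel) set" where
  "profiles n X = {1..n} \<rightarrow>\<^sub>E prefs X"

definition unanimous :: "nat \<Rightarrow> 'a set \<Rightarrow> ((nat \<Rightarrow> 'a rel) \<Rightarrow> 'a) \<Rightarrow> bool" where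
  "unanimous n X f \<longleftrightarrow>
     (\<forall>P\<in>profiles n X. \<forall>x\<in>X. (\<forall>i\<in>{1..n}. pref_top X (P i) = x) \<longrightarrow> f P = x)"

definition strategy_proof :: "nat \<Rightarrow> 'a set \<Rightarrow> ((nat \<Rightarrow> 'a rel) \<Rightarrow> 'a) \<Rightarrow> bool" where
  "strategy_proof n X f \<longleftrightarrow>
     \<not> (\<exists>i\<in>{1..n}. \<exists>P\<in>profiles n X. \<exists>P'\<in>prefs X. (f (P(i := P')), f P) \<in> P i)"

definition efficient :: "nat \<Rightarrow> 'a set \<Rightarrow> ((nat \<Rightarrow> 'a rel) \<Rightarrow> 'a) \<Rightarrow> bool" where
  "efficient n X f \<longleftrightarrow>
     (\<forall>P\<in>profiles n X. \<not> (\<exists>x\<in>X. \<forall>i\<in>{1..n}. (x, f P) \<in> P i))"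

definition tops_only :: "nat \<Rightarrow> 'a set \<Rightarrow> ((nat \<Rightarrow> 'a rel) \<Rightarrow> 'a) \<Rightarrow> bool" where
  "tops_only n X f \<longleftrightarrow>
     (\<forall>P\<in>profiles n X. \<forall>P'\<in>profiles n X.
        (\<forall>i\<in>{1..n}. pref_top X (P i) = pref_top X (P' i)) \<longrightarrow> f P = f P')"

text \<open>Unanimity is a standing assumption on rules.\<close>

definition rules :: "nat \<Rightarrow> 'a set \<Rightarrow> ((nat \<Rightarrow> 'a rel) \<Rightarrow> 'a) set" where
  "rules n X = {f \<in> profiles n X \<rightarrow>\<^sub>E X. unanimous n X f}"

definition unanimous_strategy_proof_rules :: "nat \<Rightarrow> 'a set \<Rightarrow> ((nat \<Rightarrow> 'a rel) \<Rightarrow> 'a) set" where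
  "unanimous_strategy_proof_rules n X =
     {f \<in> rules n X. unanimous n X f \<and> strategy_proof n X f}"

definition tops_only_efficient_rules :: "nat \<Rightarrow> 'a set \<Rightarrow> ((nat \<Rightarrow> 'a rel) \<Rightarrow> 'a) set" where
  "tops_only_efficient_rules n X =
     {f \<in> rules n X. tops_only n X f \<and> efficient n X f}"

end

theory Submission
  imports Defs
begin

text \<open>A strategy-proof rule is monotonic: its outcome survives every change of preferences that
  keeps below the outcome whatever was below it. Monotonicity and unanimity give efficiency, because
  a dominating alternative can be lifted to everyone's top without affecting the outcome.
  For tops-onlyness, suppose that a change of one agent's preference below its top \<open>a\<close> turns the
  outcome \<open>x\<close> into \<open>y\<close>. By monotonicity the preferences may be taken to rank \<open>a\<close>, \<open>x\<close>, \<open>y\<close> on top,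
  the other agents being split into those that prefer \<open>x\<close> to \<open>y\<close> and those that prefer \<open>y\<close> to \<open>x\<close>,
  and moving \<open>a\<close> up in the preferences of the others leads to a profile without possible outcome.\<close>

text \<open>Nested applications encode a preference with prescribed best alternatives, the outermost
  being the top; the others stay ordered as in \<open>r\<close>.\<close>

definition raise :: "'a set \<Rightarrow> 'a \<Rightarrow> 'a rel \<Rightarrow> 'a rel" where
  "raise X x r = {(u, v). u = x \<and> v \<in> X \<and> v \<noteq> x \<or> u \<noteq> x \<and> v \<noteq> x \<and> (u, v) \<in> r}"

lemma in_raise_iff [simp]:
  "(u, v) \<in> raise X x r \<longleftrightarrow> u = x \<and> v \<in> X \<and> v \<noteq> x \<or> u \<noteq> x \<and> v \<noteq> x \<and> (u, v) \<in> r"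
  by (simp add: raise_def)

lemma prefsD:
  assumes "r \<in> prefs X"
  shows prefs_field: "(u, v) \<in> r \<Longrightarrow> u \<in> X \<and> v \<in> X"
    and prefs_trans: "(u, v) \<in> r \<Longrightarrow> (v, w) \<in> r \<Longrightarrow> (u, w) \<in> r"
    and prefs_irrefl: "(u, u) \<notin> r"
    and prefs_total: "u \<in> X \<Longrightarrow> v \<in> X \<Longrightarrow> u \<noteq> v \<Longrightarrow> (u, v) \<in> r \<or> (v, u) \<in> r"
  using assms unfolding prefs_def strict_linear_order_on_def
  by (auto dest: transD irreflD simp: total_on_def)

lemma prefs_asym: "r \<in> prefs X \<Longrightarrow> (u, v) \<in> r \<Longrightarrow> (v, u) \<notin> r"
  using prefs_trans prefs_irrefl by metis

lemma raise_in_prefs: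
  assumes r: "r \<in> prefs X" and x: "x \<in> X"
  shows "raise X x r \<in> prefs X"
proof -
  have "trans (raise X x r)"
    by (rule transI) (auto dest: prefs_field[OF r] prefs_trans[OF r])
  moreover have "irrefl (raise X x r)"
    by (rule irreflI) (auto simp: prefs_irrefl[OF r])
  moreover have "total_on X (raise X x r)"
    unfolding total_on_def using prefs_total[OF r] by auto
  moreover have "raise X x r \<subseteq> X \<times> X"
    using x by (auto dest: prefs_field[OF r])
  ultimately show ?thesis
    by (simp add: prefs_def strict_linear_order_on_def)
qed

lemma profiles_upd:
  "P \<in> profiles n X \<Longrightarrow> i \<in> {1..n} \<Longrightarrow> r \<in> prefs X \<Longrightarrow> P(i := r) \<in> profiles n X"
  by (auto simp: profiles_def PiE_iff extensional_def)

lemma profiles_prefs: "P \<in> profiles n X \<Longrightarrow> i \<in> {1..n} \<Longrightarrow> P i \<in> prefs X"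
  by (auto simp: profiles_def)

text \<open>The agents switch from \<open>P\<close> to \<open>P'\<close> one after another. Hence
  \<open>step\<close> may assume that agent \<open>j\<close> still has \<open>P j\<close> and that
  the outcome has not changed so far.\<close>

lemma eq_by_single_changes:
  assumes P: "P \<in> profiles n X" and P': "P' \<in> profiles n X"
    and step: "\<And>R j. R \<in> profiles n X \<Longrightarrow> j \<in> {1..n} \<Longrightarrow> R j = P j \<Longrightarrow> f R = f P
                \<Longrightarrow> f (R(j := P' j)) = f R"
  shows "f P' = f P"
proof -
  have "override_on P P' S \<in> profiles n X \<and> f (override_on P P' S) = f P"
    if "finite S" "S \<subseteq> {1..n}" for S
    using that
  proof (induction S)
    case empty
    then show ?case using P by simp
  next
    case (insert j S)
    have j: "override_on P P' S j = P j"
      using insert.hyps by simp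
    have upd: "override_on P P' (insert j S) = (override_on P P' S)(j := P' j)"
      by (auto simp: override_on_def fun_eq_iff)
    show ?case
      unfolding upd using insert j step[of "override_on P P' S" j] profiles_prefs[OF P', of j]
        profiles_upd[of "override_on P P' S" n X j "P' j"]
      by (simp del: fun_upd_apply)
  qed
  \<comment> \<open>Both profiles are \<open>undefined\<close> outside \<open>{1..n}\<close>, so
    overriding at the agents gives equality as functions.\<close>
  moreover have "override_on P P' {1..n} = P'"
    using P P' unfolding profiles_def
    by (intro ext) (metis PiE_arb override_on_apply_in override_on_apply_notin)
  ultimately show ?thesis
    by (metis finite_atLeastAtMost subset_refl)
qed

text \<open>Agent \<open>i\<close> is tested first, so \<open>i\<close> may lie inside or outside
  \<open>A\<close>.\<close>

definition three_blocks ::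
  "nat \<Rightarrow> nat \<Rightarrow> nat set \<Rightarrow> 'a rel \<Rightarrow> 'a rel \<Rightarrow> 'a rel \<Rightarrow> nat \<Rightarrow> 'a rel" where
  "three_blocks n i A r s t = (\<lambda>j\<in>{1..n}. if j = i then r else if j \<in> A then s else t)"

lemma three_blocks_in_profiles:
  "r \<in> prefs X \<Longrightarrow> s \<in> prefs X \<Longrightarrow> t \<in> prefs X \<Longrightarrow> three_blocks n i A r s t \<in> profiles n X"
  by (simp add: three_blocks_def profiles_def)

text \<open>This symmetry allows an argument about \<open>x\<close> and \<open>y\<close> to be
  reused with the two exchanged.\<close>

lemma three_blocks_Compl: "three_blocks n i (- A) r s t = three_blocks n i A r t s"
  by (auto simp: three_blocks_def intro!: restrict_ext)

locale strategy_proof_rule =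
  fixes n :: nat and X :: "'a set" and f :: "(nat \<Rightarrow> 'a rel) \<Rightarrow> 'a"
  assumes n_pos: "0 < n"
    and finite_X: "finite X"
    and outcome_in: "P \<in> profiles n X \<Longrightarrow> f P \<in> X"
    and unanimous: "unanimous n X f"
    and strategy_proof: "strategy_proof n X f"
begin

lemma no_manipulation:
  "P \<in> profiles n X \<Longrightarrow> i \<in> {1..n} \<Longrightarrow> r \<in> prefs X \<Longrightarrow> (f (P(i := r)), f P) \<notin> P i"
  using strategy_proof by (auto simp: strategy_proof_def)

text \<open>Strategy-proofness is applied twice: agent \<open>i\<close> must not gain by the change,
  nor by returning to \<open>P i\<close> afterwards.\<close>

lemma outcome_switch:
  assumes P: "P \<in> profiles n X" and i: "i \<in> {1..n}" and r: "r \<in> prefs X"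
    and ne: "f (P(i := r)) \<noteq> f P"
  shows "(f P, f (P(i := r))) \<in> P i" "(f (P(i := r)), f P) \<in> r"
proof -
  note P' = profiles_upd[OF P i r]
  have Pi: "P i \<in> prefs X"
    using P i by (rule profiles_prefs)
  show "(f P, f (P(i := r))) \<in> P i"
    using no_manipulation[OF P i r] prefs_total[OF Pi] outcome_in[OF P] outcome_in[OF P'] ne
    by blast
  show "(f (P(i := r)), f P) \<in> r"
    using no_manipulation[OF P' i Pi] prefs_total[OF r] outcome_in[OF P] outcome_in[OF P'] ne
    by auto
qed

text \<open>If a single change moved the outcome, the old outcome would beat the new one in the old
  preference, hence by \<open>lower\<close> in the new one too, where \<open>outcome_switch\<close>
  says the opposite.\<close>

lemma monotonic:
  assumes P: "P \<in> profiles n X" and P': "P' \<in> profiles n X"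
    and lower: "\<And>j z. j \<in> {1..n} \<Longrightarrow> (f P, z) \<in> P j \<Longrightarrow> (f P, z) \<in> P' j"
  shows "f P' = f P"
proof (rule eq_by_single_changes[OF P P'])
  fix R j assume R: "R \<in> profiles n X" and j: "j \<in> {1..n}" and "R j = P j" "f R = f P"
  then have low: "(f R, z) \<in> R j \<Longrightarrow> (f R, z) \<in> P' j" for z
    using lower by simp
  have P'j: "P' j \<in> prefs X"
    using P' j by (rule profiles_prefs)
  show "f (R(j := P' j)) = f R"
  proof (rule ccontr)
    assume "f (R(j := P' j)) \<noteq> f R"
    from outcome_switch[OF R j P'j this] low show False
      using prefs_trans[OF P'j] prefs_irrefl[OF P'j] by blast
  qed
qed

lemma not_dominated:
  assumes P: "P \<in> profiles n X" and x: "x \<in> X"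
    and dom: "\<And>j. j \<in> {1..n} \<Longrightarrow> (x, f P) \<in> P j"
  shows False
proof -
  define P' where "P' = (\<lambda>j\<in>{1..n}. raise X x (P j))"
  have P': "P' \<in> profiles n X"
    using P x by (auto simp: P'_def profiles_def intro!: raise_in_prefs)
  have ne: "f P \<noteq> x"
    using dom[of 1] n_pos prefs_irrefl[OF profiles_prefs[OF P, of 1]] by auto
  \<comment> \<open>Only \<open>x\<close> moves, and it was above \<open>f P\<close> for every agent
    already.\<close>
  have "f P' = f P"
    using ne prefs_asym[OF profiles_prefs[OF P] dom]
    by (intro monotonic[OF P P']) (auto simp: P'_def)
  moreover have "pref_top X (P' j) = x" if "j \<in> {1..n}" for j
    using x that by (intro pref_top_eqI profiles_prefs[OF P' that]) (auto simp: P'_def)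
  then have "f P' = x"
    using unanimous P' x by (auto simp: unanimous_def)
  ultimately show False
    using ne by simp
qed

text \<open>Each preference is named after its three best alternatives. First \<open>a\<close>
  passes \<open>x\<close> in the last block: outcome \<open>y\<close> would survive the way back,
  and outcome \<open>a\<close> would survive the swap of \<open>x\<close> and \<open>y\<close> by
  agent \<open>i\<close>. Then \<open>a\<close> passes \<open>y\<close> in the block
  \<open>A\<close>, where the outcome \<open>x\<close> is on top.\<close>

lemma move_top_above_x:
  assumes r: "r \<in> prefs X" and X: "a \<in> X" "x \<in> X" "y \<in> X"
    and ne: "a \<noteq> x" "a \<noteq> y" "x \<noteq> y"
    and pref: "axy = raise X a (raise X x (raise X y r))" "ayx = raise X a (raise X y (raise X x r))"
      "xya = raise X x (raise X y (raise X a r))" "yxa = raise X y (raise X x (raise X a r))"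
      "xay = raise X x (raise X a (raise X y r))" "yax = raise X y (raise X a (raise X x r))"
    and x: "f (three_blocks n i A axy xya yxa) = x"
    and y: "f (three_blocks n i A ayx xya yxa) = y"
  shows "f (three_blocks n i A axy xay yax) = x"
proof -
  let ?Q = "three_blocks n i A"
  have prefs: "axy \<in> prefs X" "ayx \<in> prefs X" "xya \<in> prefs X" "yxa \<in> prefs X"
    "xay \<in> prefs X" "yax \<in> prefs X"
    unfolding pref using r X by (simp_all add: raise_in_prefs)
  note Q = three_blocks_in_profiles[of _ X _ _ n i A]
  have "f (?Q ayx xya yax) = f (?Q ayx xya yxa)"
    using y ne by (intro monotonic Q prefs) (auto simp: three_blocks_def pref split: if_splits)
  then have y': "f (?Q ayx xya yax) = y"
    using y by simp
  have "f (?Q axy xya yax) \<noteq> y"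
  proof
    assume *: "f (?Q axy xya yax) = y"
    have "f (?Q axy xya yxa) = f (?Q axy xya yax)"
      using * ne by (intro monotonic Q prefs) (auto simp: three_blocks_def pref split: if_splits)
    with * x ne show False by simp
  qed
  moreover have "f (?Q axy xya yax) \<noteq> a"
  proof
    assume *: "f (?Q axy xya yax) = a"
    have "f (?Q ayx xya yax) = f (?Q axy xya yax)"
      using * ne by (intro monotonic Q prefs) (auto simp: three_blocks_def pref split: if_splits)
    with * y' ne show False by simp
  qed
  moreover have "f (?Q axy xya yax) \<in> {a, x, y}"
  proof (rule ccontr)
    assume *: "f (?Q axy xya yax) \<notin> {a, x, y}"
    have "f (?Q axy xya yax) \<in> X"
      by (intro outcome_in Q prefs)
    with * X show False
      \<comment> \<open>All agents rank \<open>a\<close> above everything outside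
        \<open>{a, x, y}\<close>.\<close>
      by (intro not_dominated[OF Q[of axy xya yax] X(1)] prefs) (auto simp: three_blocks_def pref)
  qed
  ultimately have *: "f (?Q axy xya yax) = x"
    by simp
  have "f (?Q axy xay yax) = f (?Q axy xya yax)"
    using * ne by (intro monotonic Q prefs) (auto simp: three_blocks_def pref split: if_splits)
  with * show ?thesis by simp
qed

lemma no_switch_below_top:
  assumes r: "r \<in> prefs X" and X: "a \<in> X" "x \<in> X" "y \<in> X"
    and ne: "a \<noteq> x" "a \<noteq> y" "x \<noteq> y"
    and pref: "axy = raise X a (raise X x (raise X y r))" "ayx = raise X a (raise X y (raise X x r))"
      "xya = raise X x (raise X y (raise X a r))" "yxa = raise X y (raise X x (raise X a r))"
    and x: "f (three_blocks n i A axy xya yxa) = x"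
    and y: "f (three_blocks n i A ayx xya yxa) = y"
  shows False
proof -
  let ?Q = "three_blocks n i A"
  define xay where "xay = raise X x (raise X a (raise X y r))"
  define yax where "yax = raise X y (raise X a (raise X x r))"
  note pref' = pref xay_def yax_def
  have prefs: "axy \<in> prefs X" "ayx \<in> prefs X" "xay \<in> prefs X" "yax \<in> prefs X"
    unfolding pref' using r X by (simp_all add: raise_in_prefs)
  note Q = three_blocks_in_profiles[of _ X _ _ n i A]
  have x': "f (?Q axy xay yax) = x"
    using move_top_above_x[OF r X ne pref xay_def yax_def x y] .
  \<comment> \<open>The same lemma with \<open>x\<close> and \<open>y\<close> exchanged and
    \<open>A\<close> replaced by its complement.\<close>
  have y': "f (?Q ayx xay yax) = y"
    using move_top_above_x[where A = "- A", OF r X(1,3,2) ne(2,1) ne(3)[symmetric]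
        pref(2,1,4,3) yax_def xay_def] x y
    by (simp add: three_blocks_Compl)
  have "f (?Q ayx axy yax) = f (?Q ayx xay yax)"
    using y' ne by (intro monotonic Q prefs) (auto simp: three_blocks_def pref' split: if_splits)
  then have y'': "f (?Q ayx axy yax) = y"
    using y' by simp
  \<comment> \<open>This is the profile without possible outcome: \<open>a\<close> and
    \<open>y\<close> are excluded by monotonicity, and everything else, including \<open>x\<close>,
    is dominated by \<open>a\<close>.\<close>
  have "f (?Q axy axy yax) \<noteq> a"
  proof
    assume *: "f (?Q axy axy yax) = a"
    have "f (?Q ayx axy yax) = f (?Q axy axy yax)"
      using * ne by (intro monotonic Q prefs) (auto simp: three_blocks_def pref' split: if_splits)
    with * y'' ne show False by simp
  qed
  moreover have "f (?Q axy axy yax) \<noteq> y"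
  proof
    assume *: "f (?Q axy axy yax) = y"
    have "f (?Q axy xay yax) = f (?Q axy axy yax)"
      using * ne by (intro monotonic Q prefs) (auto simp: three_blocks_def pref' split: if_splits)
    with * x' ne show False by simp
  qed
  moreover have "f (?Q axy axy yax) \<in> X"
    by (intro outcome_in Q prefs)
  ultimately show False
    using ne X by (intro not_dominated[OF Q[of axy axy yax] X(1)] prefs)
      (auto simp: three_blocks_def pref')
qed

lemma tops_only_step:
  assumes P: "P \<in> profiles n X" and i: "i \<in> {1..n}" and s: "s \<in> prefs X"
    and top: "pref_top X (P i) = pref_top X s"
  shows "f (P(i := s)) = f P"
proof (rule ccontr)
  define x where "x = f P"
  define y where "y = f (P(i := s))"
  define a where "a = pref_top X s"
  define A where "A = {j. (x, y) \<in> P j}"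
  assume "f (P(i := s)) \<noteq> f P"
  note sw = outcome_switch[OF P i s this, folded x_def y_def]
  have neq: "x \<noteq> y"
    using \<open>f (P(i := s)) \<noteq> f P\<close> by (simp add: x_def y_def)
  have P': "P(i := s) \<in> profiles n X"
    using P i s by (rule profiles_upd)
  have r: "P i \<in> prefs X"
    using P i by (rule profiles_prefs)
  have xX: "x \<in> X" and yX: "y \<in> X"
    using outcome_in P P' by (auto simp: x_def y_def)
  then have "X \<noteq> {}" by auto
  note best = pref_top_best[OF r finite_X this, unfolded top, folded a_def]
    pref_top_best[OF s finite_X this, folded a_def]
  \<comment> \<open>\<open>P i\<close> ranks \<open>x\<close> above \<open>y\<close> and
    \<open>s\<close> ranks \<open>y\<close> above \<open>x\<close>, so neither is the common
    top.\<close>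
  have ay: "a \<noteq> y" and ax: "a \<noteq> x"
    using sw best xX yX prefs_asym[OF r] prefs_asym[OF s] neq by metis+
  have aX: "a \<in> X" using best by blast
  have iff: "(y, x) \<in> P j \<longleftrightarrow> j \<notin> A" if "j \<in> {1..n}" for j
    using prefs_total[OF profiles_prefs[OF P that]] prefs_asym[OF profiles_prefs[OF P that]]
      xX yX neq by (auto simp: A_def)
  have not_below: "(x, a) \<notin> P i" "(y, a) \<notin> s"
    using best ax ay xX yX prefs_asym[OF r] prefs_asym[OF s] by metis+
  \<comment> \<open>Below the three best alternatives any order will do, so \<open>P i\<close>
    serves as the base for all agents.\<close>
  define axy where "axy = raise X a (raise X x (raise X y (P i)))"
  define ayx where "ayx = raise X a (raise X y (raise X x (P i)))"
  define xya where "xya = raise X x (raise X y (raise X a (P i)))"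
  define yxa where "yxa = raise X y (raise X x (raise X a (P i)))"
  note pref = axy_def ayx_def xya_def yxa_def
  have prefs: "axy \<in> prefs X" "ayx \<in> prefs X" "xya \<in> prefs X" "yxa \<in> prefs X"
    unfolding pref using r aX xX yX by (simp_all add: raise_in_prefs)
  note Q = three_blocks_in_profiles[of _ X _ _ n i A]
  have "f (three_blocks n i A axy xya yxa) = f P"
  proof (intro monotonic Q P prefs)
    fix j z assume j: "j \<in> {1..n}" and z: "(f P, z) \<in> P j"
    have Pj: "P j \<in> prefs X"
      using P j by (rule profiles_prefs)
    \<comment> \<open>In the new profile only \<open>a\<close> for agent \<open>i\<close>, and
      \<open>y\<close> for the agents outside \<open>A\<close>, stand above \<open>x\<close>;
      neither was below \<open>x\<close> before.\<close>
    have "z \<in> X" "z \<noteq> x" "j = i \<Longrightarrow> z \<noteq> a" "j \<notin> A \<Longrightarrow> z \<noteq> y"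
      using z prefs_field[OF Pj z] prefs_irrefl[OF Pj] not_below by (auto simp: A_def x_def)
    then show "(f P, z) \<in> three_blocks n i A axy xya yxa j"
      using j ax neq by (simp add: three_blocks_def pref flip: x_def)
  qed
  moreover have "f (three_blocks n i A ayx xya yxa) = f (P(i := s))"
  proof (intro monotonic Q P' prefs)
    fix j z assume j: "j \<in> {1..n}" and z: "(f (P(i := s)), z) \<in> (P(i := s)) j"
    have Pj: "(P(i := s)) j \<in> prefs X"
      using P' j by (rule profiles_prefs)
    have "z \<in> X" "z \<noteq> y"
      using z prefs_field[OF Pj z] prefs_irrefl[OF Pj] by (auto simp: y_def)
    moreover have "j = i \<Longrightarrow> z \<noteq> a" "j \<noteq> i \<Longrightarrow> j \<in> A \<Longrightarrow> z \<noteq> x"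
      using z[folded y_def] not_below iff[OF j] by auto
    ultimately show "(f (P(i := s)), z) \<in> three_blocks n i A ayx xya yxa j"
      using j ay neq by (simp add: three_blocks_def pref flip: y_def)
  qed
  ultimately show False
    using no_switch_below_top[OF r aX xX yX ax ay neq pref, of i A] by (simp add: x_def y_def)
qed

lemma tops_only: "tops_only n X f"
  unfolding tops_only_def
proof (intro ballI impI)
  fix P P' assume P: "P \<in> profiles n X" and P': "P' \<in> profiles n X"
    and "\<forall>i\<in>{1..n}. pref_top X (P i) = pref_top X (P' i)"
  then have "f P' = f P"
    \<comment> \<open>Each agent still has its original preference when its turn comes, so the tops
      agree at every single change.\<close>
    by (intro eq_by_single_changes[OF P P'] tops_only_step) (auto intro: profiles_prefs)
  then show "f P = f P'" ..
qed

lemma efficient: "efficient n X f"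
  unfolding efficient_def using not_dominated by blast

end

theorem corollary1:
  fixes n :: nat and X :: "'a set"
  assumes "n \<ge> 2" and "finite X" and "card X \<ge> 3"
  shows "unanimous_strategy_proof_rules n X \<subseteq> tops_only_efficient_rules n X"
proof
  fix f assume f: "f \<in> unanimous_strategy_proof_rules n X"
  then interpret strategy_proof_rule n X f
    using assms by unfold_locales (auto simp: unanimous_strategy_proof_rules_def rules_def)
  show "f \<in> tops_only_efficient_rules n X"
    using f tops_only efficient
    by (simp add: unanimous_strategy_proof_rules_def tops_only_efficient_rules_def)
qed

end
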